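(* Let $(X,\mathcal{M},\mu)$ be a measure space with non-trivial sigma-finite measure $\mu$, $\mu(X)=\infty$. Let $1\le a<b\le\infty$ and let $\psi:(a,b)\to(0,\infty)$ satisfy $\inf_{p\in(a,b)}\psi(p)>0$. Let $f:X\to\mathbb{R}$ be a non-zero measurable function (not $\mu$-almost everywhere zero) belonging to the Grand Lebesgue Space $G\psi$, and put $\gamma:=\|f\|_{G\psi}\in(0,\infty)$. Then $$T[f](t)\le \exp\left(-\nu^*\left(\ln(t/\gamma)\right)\right)\qquad\text{for all } t>e\,\gamma .$$
   Context: For measurable $f:X\to\mathbb{R}$ and $1\le p<\infty$, $\|f\|_p:=\left[\int_X|f(x)|^p\,\mu(dx)\right]^{1/p}$. The tail function of $f$ is $T[f](t):=\mu\{x\in X:\ |f(x)|>t\}$, $t>0$. For a generating function $\psi:(a,b)\to(0,\infty)$, the Grand Lebesgue Space norm is $$\|f\|_{G\psi}:=\sup_{p\in(a,b)}\frac{\|f\|_p}{\psi(p)},$$ and $G\psi=\{f:\ \|f\|_{G\psi}<\infty\}$. Notation: $\mathrm{supp}(\psi):=(a,b)$; $\nu(p):=p\ln\psi(p)$ for $p\in(a,b)$; and $\nu^*$ is the (regional) Young–Fenchel transform $$\nu^*(s):=\sup_{p\in(a,b)}\left(ps-\nu(p)\right),\qquad s\in\mathbb{R},$$ with values in $(-\infty,\infty]$ and the convention $\exp(-\infty)=0$. *)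

theory Defs
  imports "HOL-Analysis.Analysis"
begin

text \<open>The exponential extended to \<open>[-\<infinity>, \<infinity>]\<close>, with \<open>exp (-\<infinity>) = 0\<close> and \<open>exp \<infinity> = \<infinity>\<close>.\<close>

fun exp_ext :: "ereal \<Rightarrow> ennreal" where
  "exp_ext (ereal r) = ennreal (exp r)"
| "exp_ext PInfty = \<infinity>"
| "exp_ext MInfty = 0"

text \<open>The power \<open>x\<^sup>r\<close> of \<open>x \<in> [0, \<infinity>]\<close>, intended for \<open>r > 0\<close> only (so that \<open>\<infinity>\<close> is sent to
  \<open>\<infinity>\<close> and \<open>0\<close> to \<open>0\<close>).\<close>

definition powr_ext :: "ennreal \<Rightarrow> real \<Rightarrow> ennreal" where
  "powr_ext x r = (if x = \<infinity> then \<infinity> else ennreal (enn2real x powr r))"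

definition Lp_norm :: "'a measure \<Rightarrow> real \<Rightarrow> ('a \<Rightarrow> real) \<Rightarrow> ennreal" where
  "Lp_norm M p f = powr_ext (\<integral>\<^sup>+x. ennreal (\<bar>f x\<bar> powr p) \<partial>M) (1 / p)"

definition tail_function :: "'a measure \<Rightarrow> ('a \<Rightarrow> real) \<Rightarrow> real \<Rightarrow> ennreal" where
  "tail_function M f t = emeasure M {x \<in> space M. \<bar>f x\<bar> > t}"

text \<open>The generating function \<open>\<psi>\<close> is only meaningful on its support, the open interval \<open>(a, b)\<close>
  of real numbers (\<open>b = \<infinity>\<close> allowed), which is therefore passed explicitly as \<open>S\<close>.\<close>

definition GLS_norm :: "'a measure \<Rightarrow> real set \<Rightarrow> (real \<Rightarrow> real) \<Rightarrow> ('a \<Rightarrow> real) \<Rightarrow> ennreal" where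
  "GLS_norm M S \<psi> f = (SUP p\<in>S. Lp_norm M p f / ennreal (\<psi> p))"

definition GLS :: "'a measure \<Rightarrow> real set \<Rightarrow> (real \<Rightarrow> real) \<Rightarrow> ('a \<Rightarrow> real) set" where
  "GLS M S \<psi> = {f \<in> borel_measurable M. GLS_norm M S \<psi> f < \<infinity>}"

definition nu :: "(real \<Rightarrow> real) \<Rightarrow> real \<Rightarrow> real" where
  "nu \<psi> p = p * ln (\<psi> p)"

definition Young_Fenchel :: "real set \<Rightarrow> (real \<Rightarrow> real) \<Rightarrow> real \<Rightarrow> ereal" where
  "Young_Fenchel S g s = (SUP p\<in>S. ereal (p * s - g p))"

end

theory Submission
  imports Defs
begin

text \<open>Chebyshev's inequality for the \<open>p\<close>-th moment gives
  \<open>T[f](t) \<le> (\<gamma> \<psi>(p) / t)\<^sup>p = exp (- (p ln (t / \<gamma>) - \<nu>(p)))\<close> for every \<open>p\<close> in \<open>(a, b)\<close>;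
  optimising over \<open>p\<close> turns the exponent into the Young--Fenchel transform.\<close>

text \<open>The defining equations speak of the constructors \<open>PInfty\<close> and
  \<open>MInfty\<close>; simplification needs them for \<open>\<infinity>\<close> and
  \<open>- \<infinity>\<close>.\<close>

lemma exp_ext_infinity [simp]: "exp_ext \<infinity> = \<infinity>" "exp_ext (- \<infinity>) = 0"
  using exp_ext.simps(2,3) by (simp_all only: PInfty_eq_infinity MInfty_eq_minfinity)

lemma exp_ext_mono:
  assumes "x \<le> y"
  shows "exp_ext x \<le> exp_ext y"
  using assms by (cases x; cases y) (auto intro: ennreal_leI)

text \<open>This moves the optimisation over \<open>p\<close> into the exponent. Taking logarithms
  turns the bounds into \<open>h p \<le> - ln T\<close>, so \<open>- ln T\<close> also bounds the
  supremum, and monotonicity of \<open>exp_ext\<close> returns to \<open>T\<close>.\<close>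

lemma le_exp_ext_uminus_SUP:
  assumes "S \<noteq> {}" and bound: "\<And>p. p \<in> S \<Longrightarrow> T \<le> ennreal (exp (- h p))"
  shows "T \<le> exp_ext (- (SUP p\<in>S. ereal (h p)))"
proof -
  obtain p0 where "p0 \<in> S" using assms(1) by blast
  \<comment> \<open>A single index already bounds \<open>T\<close> by a real number, so
    \<open>T\<close> may be treated as a real.\<close>
  then have "T < top"
    using bound[of p0] by (metis ennreal_less_top le_less_trans)
  then obtain \<tau> where T: "T = ennreal \<tau>" and "0 \<le> \<tau>"
    by (cases T) auto
  show ?thesis
  proof (cases "\<tau> = 0")
    \<comment> \<open>Here \<open>ln \<tau>\<close> would not represent the logarithm of zero, but
      the claim is trivial.\<close>
    case True
    then show ?thesis by (simp add: T)
  next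
    case False
    with \<open>0 \<le> \<tau>\<close> have "0 < \<tau>" by simp
    have "h p \<le> - ln \<tau>" if "p \<in> S" for p
    proof -
      have "\<tau> \<le> exp (- h p)"
        using bound[OF that] by (simp add: T ennreal_le_iff)
      then have "ln \<tau> \<le> - h p"
        using \<open>0 < \<tau>\<close> by (metis exp_gt_zero ln_exp ln_le_cancel_iff)
      then show ?thesis by simp
    qed
    then have "(SUP p\<in>S. ereal (h p)) \<le> ereal (- ln \<tau>)"
      by (intro SUP_least) simp
    then have "ereal (ln \<tau>) \<le> - (SUP p\<in>S. ereal (h p))"
      by (metis ereal_minus_le_minus ereal_uminus_uminus uminus_ereal.simps(1))
    from exp_ext_mono[OF this] show ?thesis
      using \<open>0 < \<tau>\<close> by (simp add: T)
  qed
qed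

lemma nn_integral_le_of_Lp_norm_le:
  assumes "0 < p" "0 \<le> C" and norm: "Lp_norm M p f \<le> ennreal C"
  shows "(\<integral>\<^sup>+x. ennreal (\<bar>f x\<bar> powr p) \<partial>M) \<le> ennreal (C powr p)"
proof -
  let ?I = "\<integral>\<^sup>+x. ennreal (\<bar>f x\<bar> powr p) \<partial>M"
  \<comment> \<open>\<open>powr_ext\<close> sends \<open>\<infinity>\<close> to
    \<open>\<infinity>\<close>, so an infinite integral would contradict the real bound on the
    norm.\<close>
  have "?I \<noteq> top"
    using norm by (auto simp: Lp_norm_def powr_ext_def top_unique)
  then obtain i where I: "?I = ennreal i" and "0 \<le> i"
    by (cases ?I) auto
  have "i powr (1 / p) \<le> C"
    using norm \<open>0 \<le> i\<close> \<open>0 \<le> C\<close> by (simp add: Lp_norm_def powr_ext_def I ennreal_le_iff)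
  then have "(i powr (1 / p)) powr p \<le> C powr p"
    using \<open>0 < p\<close> by (intro powr_mono2) auto
  then show ?thesis
    using \<open>0 < p\<close> \<open>0 \<le> i\<close> by (simp add: I powr_powr ennreal_leI)
qed

text \<open>Chebyshev: \<open>t powr p\<close> times the indicator of the tail set lies below
  \<open>\<bar>f x\<bar> powr p\<close> pointwise; integrate.\<close>

lemma tail_function_le:
  assumes [measurable]: "f \<in> borel_measurable M"
    and "0 < p" "0 < t" "0 \<le> C" "Lp_norm M p f \<le> ennreal C"
  shows "tail_function M f t \<le> ennreal ((C / t) powr p)"
proof -
  let ?A = "{x \<in> space M. \<bar>f x\<bar> > t}"
  have "ennreal (t powr p) * emeasure M ?A = (\<integral>\<^sup>+x. ennreal (t powr p) * indicator ?A x \<partial>M)"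
    by (subst nn_integral_cmult_indicator) auto
  also have "\<dots> \<le> (\<integral>\<^sup>+x. ennreal (\<bar>f x\<bar> powr p) \<partial>M)"
    using \<open>0 < p\<close> \<open>0 < t\<close>
    by (intro nn_integral_mono) (auto simp: indicator_def intro!: ennreal_leI powr_mono2)
  also have "\<dots> \<le> ennreal (C powr p)"
    using assms by (intro nn_integral_le_of_Lp_norm_le)
  finally have *: "ennreal (t powr p) * emeasure M ?A \<le> ennreal (C powr p)" .
  have tp: "0 < t powr p" using \<open>0 < t\<close> by simp
  \<comment> \<open>The measure is not yet known to be finite, so the positive real factor
    \<open>t powr p\<close> is cancelled by multiplying with its inverse in
    \<open>ennreal\<close>.\<close>
  then have "emeasure M ?A = ennreal (inverse (t powr p)) * (ennreal (t powr p) * emeasure M ?A)"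
    by (simp add: mult.assoc[symmetric] ennreal_mult[symmetric])
  also have "\<dots> \<le> ennreal (inverse (t powr p)) * ennreal (C powr p)"
    by (intro mult_left_mono *) simp
  also have "\<dots> = ennreal ((C / t) powr p)"
    using \<open>0 < t\<close> \<open>0 \<le> C\<close> by (simp add: ennreal_mult[symmetric] powr_divide field_simps)
  finally show ?thesis by (simp add: tail_function_def)
qed

lemma Lp_norm_le_GLS_norm:
  assumes "p \<in> S" "0 < \<psi> p" and "GLS_norm M S \<psi> f = ennreal \<gamma>" "0 \<le> \<gamma>"
  shows "Lp_norm M p f \<le> ennreal (\<gamma> * \<psi> p)"
proof -
  have "Lp_norm M p f / ennreal (\<psi> p) \<le> ennreal \<gamma>"
    using assms(1,3) unfolding GLS_norm_def by (metis SUP_upper)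
  then have "Lp_norm M p f / ennreal (\<psi> p) * ennreal (\<psi> p) \<le> ennreal \<gamma> * ennreal (\<psi> p)"
    by (intro mult_right_mono) simp_all
  then show ?thesis
    using assms by (simp add: ennreal_times_divide ennreal_divide_times ennreal_mult
        ennreal_mult_divide_eq)
qed

text \<open>The moment bound with constant 0 makes the integral of a nonnegative function vanish.
  This serves to exclude \<open>\<gamma> = 0\<close>.\<close>

lemma AE_zero_of_Lp_norm_eq_0:
  assumes [measurable]: "f \<in> borel_measurable M" and "0 < p" "Lp_norm M p f = 0"
  shows "AE x in M. f x = 0"
proof -
  have "(\<integral>\<^sup>+x. ennreal (\<bar>f x\<bar> powr p) \<partial>M) = 0"
    using nn_integral_le_of_Lp_norm_le[of p 0 M f] assms by simp
  then have "AE x in M. ennreal (\<bar>f x\<bar> powr p) = 0"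
    by (subst (asm) nn_integral_0_iff_AE) auto
  then show ?thesis by eventually_elim simp
qed

theorem theorem2p1:
  fixes M :: "'a measure"
    and a :: real and b :: ereal
    and \<psi> :: "real \<Rightarrow> real"
    and f :: "'a \<Rightarrow> real"
    and \<gamma> :: real
  assumes "sigma_finite_measure M"
    and "emeasure M (space M) = \<infinity>"
    and "1 \<le> a" and "ereal a < b"
    and "\<forall>p \<in> einterval (ereal a) b. 0 < \<psi> p"
    and "0 < (INF p \<in> einterval (ereal a) b. \<psi> p)"
    and "f \<in> borel_measurable M"
    and "\<not> (AE x in M. f x = 0)"
    and "f \<in> GLS M (einterval (ereal a) b) \<psi>"
    and "\<gamma> = enn2real (GLS_norm M (einterval (ereal a) b) \<psi> f)"
  shows "0 < GLS_norm M (einterval (ereal a) b) \<psi> f \<and>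
         GLS_norm M (einterval (ereal a) b) \<psi> f < \<infinity> \<and>
         (\<forall>t. t > exp 1 * \<gamma> \<longrightarrow>
           tail_function M f t
             \<le> exp_ext (- Young_Fenchel (einterval (ereal a) b) (nu \<psi>) (ln (t / \<gamma>))))"
proof -
  let ?S = "einterval (ereal a) b"
  let ?N = "GLS_norm M ?S \<psi> f"
  have fin: "?N < \<infinity>" using assms(9) by (simp add: GLS_def)
  \<comment> \<open>Finiteness makes \<open>enn2real\<close> lossless; it would send
    \<open>\<infinity>\<close> to 0.\<close>
  then have N: "?N = ennreal \<gamma>" and "0 \<le> \<gamma>"
    using assms(10) by auto
  \<comment> \<open>One exponent inside the interval serves twice: to show
    \<open>\<gamma> \<noteq> 0\<close> and to have a nonempty index set for the supremum.\<close>
  obtain p0 where "ereal a < ereal p0" "ereal p0 < b"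
    using ereal_dense2[OF assms(4)] by blast
  then have p0: "p0 \<in> ?S" by (simp add: einterval_def)
  have pos: "0 < p" if "p \<in> ?S" for p
    using that assms(3) by (simp add: einterval_def)
  have psi: "0 < \<psi> p" if "p \<in> ?S" for p
    using that assms(5) by blast
  note Lp = Lp_norm_le_GLS_norm[OF _ psi N \<open>0 \<le> \<gamma>\<close>]
  \<comment> \<open>This makes \<open>t / \<gamma>\<close> a true quotient instead of the default
    value 0 of division by zero.\<close>
  have "\<gamma> \<noteq> 0"
  proof
    assume "\<gamma> = 0"
    then have "Lp_norm M p0 f = 0" using Lp[OF p0 p0] by simp
    with AE_zero_of_Lp_norm_eq_0[OF assms(7) pos[OF p0]] assms(8) show False by blast
  qed
  with \<open>0 \<le> \<gamma>\<close> have "0 < \<gamma>" by simp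
  have "tail_function M f t \<le> exp_ext (- Young_Fenchel ?S (nu \<psi>) (ln (t / \<gamma>)))"
    if t: "t > exp 1 * \<gamma>" for t
    unfolding Young_Fenchel_def
  proof (rule le_exp_ext_uminus_SUP)
    show "?S \<noteq> {}" using p0 by blast
    fix p assume p: "p \<in> ?S"
    have "0 < exp 1 * \<gamma>" using \<open>0 < \<gamma>\<close> by simp
    with t have "0 < t" by linarith
    have "tail_function M f t \<le> ennreal ((\<gamma> * \<psi> p / t) powr p)"
      using p \<open>0 < t\<close> \<open>0 < \<gamma>\<close> psi[OF p] pos[OF p]
      by (intro tail_function_le assms(7) Lp) auto
    \<comment> \<open>All three quantities are positive, so the logarithm of the base splits as
      \<open>ln (\<psi> p) - ln (t / \<gamma>)\<close>.\<close>
    also have "(\<gamma> * \<psi> p / t) powr p = exp (- (p * ln (t / \<gamma>) - nu \<psi> p))"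
      using \<open>0 < t\<close> \<open>0 < \<gamma>\<close> psi[OF p]
      by (simp add: powr_def nu_def ln_div ln_mult algebra_simps)
    finally show "tail_function M f t \<le> ennreal (exp (- (p * ln (t / \<gamma>) - nu \<psi> p)))" .
  qed
  with fin N \<open>0 < \<gamma>\<close> show ?thesis by simp
qed

end
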